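(* For every $n \geq 1$ and every string $T$ of length $n$, $\mathsf{e}(T[2..n]) - \mathsf{e}(T) \leq \mathsf{e}(T) - 2$. That is, the worst-case additive sensitivity of the CDAWG size under left-end deletion is at most $\mathsf{e}-2$.
   Context: Strings are finite sequences of characters from an alphabet $\Sigma$; $\varepsilon$ is the empty string, $T[i..j]=T[i]\cdots T[j]$ (and $T[2..1]=\varepsilon$). For a string $T$, $\mathrm{Substr}(T)$ is its set of substrings (including $\varepsilon$). A substring $u$ of $T$ is left-maximal in $T$ if $u$ is a prefix of $T$ or there are distinct characters $c \neq d$ with $cu, du \in \mathrm{Substr}(T)$; it is right-maximal in $T$ if $u$ is a suffix of $T$ or there are distinct characters $c\neq d$ with $uc, ud \in \mathrm{Substr}(T)$. $\mathsf{M}(T)$ is the set of substrings of $T$ that are both left- and right-maximal (it contains $\varepsilon$ and $T$). The compact directed acyclic word graph $\mathrm{CDAWG}(T)$ has exactly one node for each element of $\mathsf{M}(T)$, and the outgoing edges of the node $x$ are in bijection with the characters $c$ such that $xc \in \mathrm{Substr}(T)$. For a string $w$, $d_T(w)$ is the number of distinct characters $c$ with $wc \in \mathrm{Substr}(T)$. The size of the CDAWG is $\mathsf{e}(T) = \sum_{x \in \mathsf{M}(T)} d_T(x)$, its number of edges. *)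

theory Defs
  imports Main "HOL-Library.Sublist"
begin

definition Substr :: "'a list \<Rightarrow> 'a list set" where
  "Substr T = {u. sublist u T}"

(* T[i..j] with 1-based, inclusive positions; empty when j < i. *)
definition slice :: "'a list \<Rightarrow> nat \<Rightarrow> nat \<Rightarrow> 'a list" where
  "slice T i j = map (\<lambda>k. T ! (k - 1)) [i..<Suc j]"

lemma slice_2_length: "slice T 2 (length T) = tl T"
  by (rule nth_equalityI) (auto simp: slice_def nth_tl simp del: upt_Suc)

definition left_maximal :: "'a list \<Rightarrow> 'a list \<Rightarrow> bool" where
  "left_maximal T u \<longleftrightarrow> u \<in> Substr T \<and>
     (prefix u T \<or> (\<exists>c d. c \<noteq> d \<and> c # u \<in> Substr T \<and> d # u \<in> Substr T))"

definition right_maximal :: "'a list \<Rightarrow> 'a list \<Rightarrow> bool" where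
  "right_maximal T u \<longleftrightarrow> u \<in> Substr T \<and>
     (suffix u T \<or> (\<exists>c d. c \<noteq> d \<and> u @ [c] \<in> Substr T \<and> u @ [d] \<in> Substr T))"

definition maximal_substrs :: "'a list \<Rightarrow> 'a list set" where
  "maximal_substrs T = {u \<in> Substr T. left_maximal T u \<and> right_maximal T u}"

definition out_degree :: "'a list \<Rightarrow> 'a list \<Rightarrow> nat" where
  "out_degree T w = card {c. w @ [c] \<in> Substr T}"

definition cdawg_size :: "'a list \<Rightarrow> nat" where
  "cdawg_size T = (\<Sum>x\<in>maximal_substrs T. out_degree T x)"

(* Neither the sum nor the cardinality above ever falls back to its
   default value 0 on an infinite set. *)
lemma finite_Substr: "finite (Substr T)"
proof -
  have "Substr T = set (sublists T)"
    by (auto simp: Substr_def)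
  then show ?thesis by simp
qed

lemma finite_maximal_substrs: "finite (maximal_substrs T)"
  by (rule finite_subset[OF _ finite_Substr[of T]]) (auto simp: maximal_substrs_def)

lemma finite_out_chars: "finite {c. w @ [c] \<in> Substr T}"
proof (rule finite_subset)
  show "{c. w @ [c] \<in> Substr T} \<subseteq> set T"
    using set_mono_sublist by (fastforce simp: Substr_def)
qed simp

end

theory Submission imports Defs begin

text \<open>
  Write \<open>T = a # S\<close>. Right-maximality in \<open>S\<close> passes to \<open>T\<close>, so a node \<open>x\<close> of the CDAWG of \<open>S\<close>
  that is no node for \<open>T\<close> is a prefix of \<open>S\<close> all of whose occurrences in \<open>T\<close> are preceded
  by \<open>a\<close>. Then \<open>a # x\<close> is a node for \<open>T\<close> with the same right extensions as \<open>x\<close>. Hence the old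
  nodes contribute at most \<open>e(T)\<close>, and the new ones, injected by \<open>x \<mapsto> a # x\<close> into the nodes
  of \<open>T\<close> other than the empty string, at most \<open>e(T) - d\<^sub>T(\<epsilon>)\<close>. This suffices if \<open>T\<close> has two
  distinct characters; otherwise there are no new nodes, and the node \<open>S\<close> loses its
  outgoing edge.
\<close>

lemma Substr_Cons: "Substr S \<subseteq> Substr (a # S)"
  by (auto simp: Substr_def sublist_Cons_right)

lemma out_degree_mono: "Substr S \<subseteq> Substr T \<Longrightarrow> out_degree S x \<le> out_degree T x"
  unfolding out_degree_def by (rule card_mono[OF finite_out_chars]) auto

lemma out_degree_Nil: "out_degree T [] = card (set T)"
proof -
  have "{c. [] @ [c] \<in> Substr T} = set T"
    by (auto simp: Substr_def sublist_def in_set_conv_decomp)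
  then show ?thesis by (simp add: out_degree_def)
qed

lemma Nil_maximal: "[] \<in> maximal_substrs T"
  by (auto simp: maximal_substrs_def left_maximal_def right_maximal_def Substr_def)

lemma right_maximal_Cons:
  assumes "right_maximal S x"
  shows "right_maximal (a # S) x"
  using assms Substr_Cons[of S a] unfolding right_maximal_def
  by (meson subsetD suffix_ConsI)

text \<open>Right-maximality survives prepending \<open>a\<close>, so left-maximality is what fails.
  Two distinct left extensions within \<open>S\<close> would persist in \<open>a # S\<close>, so
  \<open>x\<close> can be left-maximal in \<open>S\<close> only as a prefix.\<close>

lemma not_maximal_Cons_prefix:
  assumes "x \<in> maximal_substrs S" "x \<notin> maximal_substrs (a # S)"
  shows "prefix x S" and "\<not> left_maximal (a # S) x" and "x \<in> Substr (a # S)"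
  using assms right_maximal_Cons[of S x a] Substr_Cons[of S a]
  unfolding maximal_substrs_def left_maximal_def by blast+

text \<open>An occurrence at the start of \<open>T\<close>, or one preceded by some
  \<open>c \<noteq> a\<close>, would make \<open>x\<close> left-maximal.\<close>

lemma occurrence_preceded:
  assumes "a # x \<in> Substr T" "\<not> left_maximal T x" "T = p @ x @ r"
  obtains p' where "p = p' @ [a]"
proof (cases p rule: rev_cases)
  case Nil
  then have "left_maximal T x"
    using assms(3) by (auto simp: left_maximal_def Substr_def)
  then show ?thesis using assms(2) by simp
next
  case (snoc p' c)
  then have T: "T = p' @ (c # x) @ r" using assms(3) by simp
  then have "c # x \<in> Substr T" unfolding Substr_def sublist_def by blast
  moreover have "x \<in> Substr T" unfolding assms(3) by (simp add: Substr_def)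
  ultimately have "c = a"
    using assms(1,2) by (auto simp: left_maximal_def)
  then show ?thesis using snoc that by simp
qed

lemma new_node:
  assumes "x \<in> maximal_substrs S" "x \<notin> maximal_substrs (a # S)"
  shows "a # x \<in> maximal_substrs (a # S)"
    and "out_degree S x \<le> out_degree (a # S) (a # x)"
proof -
  let ?T = "a # S"
  note np = not_maximal_Cons_prefix[OF assms]
  have pre: "prefix (a # x) ?T" using np(1) by simp
  then have ax: "a # x \<in> Substr ?T" by (simp add: Substr_def)
  \<comment> \<open>\<open>ext\<close> and \<open>suf\<close> carry the two alternatives of
    right-maximality from \<open>x\<close> to \<open>a # x\<close>: the \<open>a\<close> before each
    occurrence is absorbed, and what follows stays the same.\<close>
  have ext: "(a # x) @ [c] \<in> Substr ?T" if "x @ [c] \<in> Substr ?T" for c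
  proof -
    from that obtain p s where T: "?T = p @ x @ [c] @ s"
      by (auto simp: Substr_def sublist_def)
    then obtain p' where "p = p' @ [a]"
      using occurrence_preceded[OF ax np(2)] by metis
    then have "?T = p' @ ((a # x) @ [c]) @ s" using T by simp
    then show ?thesis unfolding Substr_def sublist_def by blast
  qed
  have suf: "suffix (a # x) ?T" if "suffix x ?T"
  proof -
    from that obtain p where T: "?T = p @ x @ []" by (auto simp: suffix_def)
    then obtain p' where "p = p' @ [a]"
      using occurrence_preceded[OF ax np(2)] by metis
    then have "?T = p' @ (a # x)" using T by simp
    then show ?thesis unfolding suffix_def by blast
  qed
  have "right_maximal ?T x"
    using assms(1) right_maximal_Cons by (auto simp: maximal_substrs_def)
  then have "right_maximal ?T (a # x)"
    using ext suf ax unfolding right_maximal_def by blast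
  then show "a # x \<in> maximal_substrs ?T"
    using ax pre by (simp add: maximal_substrs_def left_maximal_def)
  have "out_degree S x \<le> out_degree ?T x"
    by (rule out_degree_mono[OF Substr_Cons])
  also have "\<dots> \<le> out_degree ?T (a # x)"
    unfolding out_degree_def by (rule card_mono[OF finite_out_chars]) (use ext in auto)
  finally show "out_degree S x \<le> out_degree ?T (a # x)" .
qed

text \<open>The summand \<open>card (set (a # S))\<close> is the out-degree of the node
  \<open>[]\<close>, which \<open>x \<mapsto> a # x\<close> never hits.\<close>

lemma cdawg_size_tail_bound:
  "cdawg_size S + card (set (a # S)) \<le> 2 * cdawg_size (a # S)"
proof -
  let ?T = "a # S"
  let ?N = "maximal_substrs S - maximal_substrs ?T"
  note fin = finite_maximal_substrs
  have "cdawg_size S = sum (out_degree S) (maximal_substrs S \<inter> maximal_substrs ?T)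
      + sum (out_degree S) ?N"
    unfolding cdawg_size_def by (rule sum.Int_Diff[OF fin])
  moreover have "sum (out_degree S) (maximal_substrs S \<inter> maximal_substrs ?T) \<le> cdawg_size ?T"
  proof -
    have "sum (out_degree S) (maximal_substrs S \<inter> maximal_substrs ?T)
        \<le> sum (out_degree ?T) (maximal_substrs S \<inter> maximal_substrs ?T)"
      by (rule sum_mono) (rule out_degree_mono[OF Substr_Cons])
    also have "\<dots> \<le> cdawg_size ?T"
      unfolding cdawg_size_def by (rule sum_mono2[OF fin]) auto
    finally show ?thesis .
  qed
  moreover have "sum (out_degree S) ?N + card (set ?T) \<le> cdawg_size ?T"
  proof -
    have "sum (out_degree S) ?N \<le> (\<Sum>x\<in>?N. out_degree ?T (a # x))"
      by (rule sum_mono) (use new_node(2) in auto)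
    also have "\<dots> = sum (out_degree ?T) ((#) a ` ?N)"
      by (subst sum.reindex) auto
    also have "\<dots> \<le> sum (out_degree ?T) (maximal_substrs ?T - {[]})"
      by (rule sum_mono2) (use fin new_node(1) in auto)
    finally show ?thesis
      unfolding cdawg_size_def out_degree_Nil[symmetric]
      using sum.remove[OF fin Nil_maximal, of "out_degree ?T" ?T] by linarith
  qed
  ultimately show ?thesis by linarith
qed

text \<open>Covers the unary case, where \<open>cdawg_size_tail_bound\<close> falls short by one
  because \<open>card (set (a # S)) = 1\<close>.\<close>

lemma cdawg_size_replicate_less:
  assumes T: "a # S = replicate (Suc m) a"
  shows "cdawg_size S < cdawg_size (a # S)"
proof -
  let ?T = "a # S"
  have S: "S = replicate m a" using T by simp
  have TS: "?T = S @ [a]" using T S by (metis replicate_Suc replicate_append_same)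
  have sub: "maximal_substrs S \<subseteq> maximal_substrs ?T"
  proof
    fix x assume x: "x \<in> maximal_substrs S"
    show "x \<in> maximal_substrs ?T"
    proof (rule ccontr)
      assume n: "x \<notin> maximal_substrs ?T"
      note np = not_maximal_Cons_prefix[OF x n]
      \<comment> \<open>Since \<open>S\<close> is itself a prefix of \<open>?T\<close>, prefixes of
        \<open>S\<close> remain left-maximal, so no new node arises.\<close>
      have "prefix x ?T" using np(1) TS by (metis prefix_prefix)
      then show False using np(2,3) by (simp add: left_maximal_def)
    qed
  qed
  \<comment> \<open>Strictness comes from the node \<open>S\<close>: it is a sink for
    \<open>S\<close>, but can be extended by the last \<open>a\<close> of \<open>?T\<close>.\<close>
  have SS: "S \<in> maximal_substrs S"
    by (auto simp: maximal_substrs_def left_maximal_def right_maximal_def Substr_def)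
  have "{c. S @ [c] \<in> Substr S} = {}"
    by (auto simp: Substr_def dest: sublist_length_le)
  then have "out_degree S S = 0"
    by (simp add: out_degree_def)
  moreover have "out_degree ?T S > 0"
  proof -
    have "a \<in> {c. S @ [c] \<in> Substr ?T}" by (simp only: TS) (simp add: Substr_def)
    then show ?thesis unfolding out_degree_def using finite_out_chars[of S ?T]
      by (metis card_gt_0_iff empty_iff)
  qed
  ultimately have "\<exists>x\<in>maximal_substrs S. out_degree S x < out_degree ?T x"
    using SS by (intro bexI[of _ S]) simp_all
  then have "cdawg_size S < sum (out_degree ?T) (maximal_substrs S)"
    unfolding cdawg_size_def
    by (intro sum_strict_mono_ex1 finite_maximal_substrs ballI out_degree_mono Substr_Cons)
  also have "\<dots> \<le> cdawg_size ?T"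
    unfolding cdawg_size_def by (rule sum_mono2[OF finite_maximal_substrs sub]) auto
  finally show ?thesis .
qed

theorem theorem3:
  fixes T :: "'a list" and n :: nat
  assumes "n \<ge> 1" and "length T = n"
  shows "int (cdawg_size (slice T 2 n)) - int (cdawg_size T) \<le> int (cdawg_size T) - 2"
proof -
  obtain a S where T: "T = a # S" using assms by (cases T) auto
  have sl: "slice T 2 n = S" using slice_2_length[of T] assms(2) T by simp
  have "cdawg_size S + 2 \<le> 2 * cdawg_size T"
  proof (cases "set T = {a}")
    case True
    then have "T = replicate (length T) a" by (intro replicate_eqI) auto
    then have "cdawg_size S < cdawg_size T"
      using cdawg_size_replicate_less[of a S "length S"] T by simp
    \<comment> \<open>The strict inequality also forces \<open>cdawg_size T \<ge> 1\<close>, which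
      supplies the second unit.\<close>
    then show ?thesis by linarith
  next
    case False
    then obtain b where "b \<noteq> a" "b \<in> set T" using T by auto
    then have "card {a, b} \<le> card (set T)" using T by (intro card_mono) auto
    then have "2 \<le> card (set T)" using \<open>b \<noteq> a\<close> by simp
    then show ?thesis using cdawg_size_tail_bound[of S a] unfolding T by linarith
  qed
  then show ?thesis unfolding sl by linarith
qed

end
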